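(* Let $h(t)=t^\top Gt+2w^\top t$ for $t\in\mathbb{R}^{nM}$. The problem (QAP) $$\min_{t\in\mathbb{R}^{nM}} h(t)\quad\text{s.t. } \boldsymbol{e}^\top\bar t_j=1,\ j=1,\ldots,n,\quad t\in\{0,1\}^{nM},$$ and the problem (SQP1) $$\min_{t\in\mathbb{R}^{nM}} h(t)\quad\text{s.t. } \boldsymbol{e}^\top\bar t_j=1,\ j=1,\ldots,n,\quad t\geqslant 0,\quad \|t\|_0\leqslant n,$$ are equivalent.
   Context: $m,n\geqslant1$ and $M\geqslant 2$ are integers, $H\in\mathbb{C}^{m\times n}$, $r\in\mathbb{C}^m$; $(\cdot)^\dagger$ is the conjugate transpose. $Q=H^\dagger H$, $c=-H^\dagger r$. $\widehat Q=\begin{bmatrix}\mathrm{Re}(Q)&-\mathrm{Im}(Q)\\ \mathrm{Im}(Q)&\mathrm{Re}(Q)\end{bmatrix}\in\mathbb{R}^{2n\times 2n}$, $\hat c=\begin{bmatrix}\mathrm{Re}(c)\\ \mathrm{Im}(c)\end{bmatrix}\in\mathbb{R}^{2n}$. $\theta_k=2(k-1)\pi/M$ for $k=1,\ldots,M$; $\alpha=(\cos\theta_1,\ldots,\cos\theta_M)^\top$, $\beta=(\sin\theta_1,\ldots,\sin\theta_M)^\top\in\mathbb{R}^M$. $A=I\otimes\alpha^\top$, $B=I\otimes\beta^\top\in\mathbb{R}^{n\times nM}$ ($I$ the $n\times n$ identity, $\otimes$ the Kronecker product), $P=\begin{bmatrix}A\\ B\end{bmatrix}\in\mathbb{R}^{2n\times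 nM}$, $G=P^\top\widehat QP\in\mathbb{R}^{nM\times nM}$, $w=P^\top\hat c\in\mathbb{R}^{nM}$. A vector $t\in\mathbb{R}^{nM}$ is partitioned as $t=(\bar t_1^\top,\ldots,\bar t_n^\top)^\top$ with blocks $\bar t_j\in\mathbb{R}^M$. $\boldsymbol{e}$ is the all-ones vector, $\|t\|_0$ is the number of nonzero entries of $t$, and $t\geqslant0$ is entrywise. *)

theory Defs
  imports "Jordan_Normal_Form.Schur_Decomposition" "HOL-Library.Extended_Real"
begin

text \<open>Vectors and matrices are those of \<open>Jordan_Normal_Form\<close>, so all positions are
  counted from 0.\<close>

definition Q_mat :: "complex mat \<Rightarrow> complex mat" where
  "Q_mat H = mat_adjoint H * H"

definition c_vec :: "complex mat \<Rightarrow> complex vec \<Rightarrow> complex vec" where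
  "c_vec H r = - (mat_adjoint H *\<^sub>v r)"

definition Q_hat :: "complex mat \<Rightarrow> real mat" where
  "Q_hat H = four_block_mat
     (map_mat Re (Q_mat H)) (- map_mat Im (Q_mat H))
     (map_mat Im (Q_mat H)) (map_mat Re (Q_mat H))"

definition c_hat :: "complex mat \<Rightarrow> complex vec \<Rightarrow> real vec" where
  "c_hat H r = map_vec Re (c_vec H r) @\<^sub>v map_vec Im (c_vec H r)"

text \<open>The angle \<open>theta M k\<close> is meant for \<open>k = 1, \<dots>, M\<close>; the entry of \<open>alpha M\<close> and
  \<open>beta M\<close> at position \<open>k\<close> therefore uses the angle with number \<open>k + 1\<close>.\<close>

definition theta :: "nat \<Rightarrow> nat \<Rightarrow> real" where
  "theta M k = 2 * (real k - 1) * pi / real M"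

definition alpha :: "nat \<Rightarrow> real vec" where
  "alpha M = vec M (\<lambda>k. cos (theta M (k + 1)))"

definition beta :: "nat \<Rightarrow> real vec" where
  "beta M = vec M (\<lambda>k. sin (theta M (k + 1)))"

definition kronecker :: "'a :: times mat \<Rightarrow> 'a mat \<Rightarrow> 'a mat" where
  "kronecker X Y = mat (dim_row X * dim_row Y) (dim_col X * dim_col Y)
     (\<lambda>(i, j). X $$ (i div dim_row Y, j div dim_col Y) * Y $$ (i mod dim_row Y, j mod dim_col Y))"

definition P_mat :: "nat \<Rightarrow> nat \<Rightarrow> real mat" where
  "P_mat n M = kronecker (1\<^sub>m n) (mat_of_row (alpha M)) @\<^sub>r kronecker (1\<^sub>m n) (mat_of_row (beta M))"

definition G_mat :: "nat \<Rightarrow> nat \<Rightarrow> complex mat \<Rightarrow> real mat" where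
  "G_mat n M H = transpose_mat (P_mat n M) * Q_hat H * P_mat n M"

definition w_vec :: "nat \<Rightarrow> nat \<Rightarrow> complex mat \<Rightarrow> complex vec \<Rightarrow> real vec" where
  "w_vec n M H r = transpose_mat (P_mat n M) *\<^sub>v c_hat H r"

definition h_obj :: "nat \<Rightarrow> nat \<Rightarrow> complex mat \<Rightarrow> complex vec \<Rightarrow> real vec \<Rightarrow> real" where
  "h_obj n M H r t = t \<bullet> (G_mat n M H *\<^sub>v t) + 2 * (w_vec n M H r \<bullet> t)"

definition block :: "nat \<Rightarrow> real vec \<Rightarrow> nat \<Rightarrow> real vec" where
  "block M t j = vec M (\<lambda>k. t $ (j * M + k))"

definition ones_vec :: "nat \<Rightarrow> real vec" where
  "ones_vec M = vec M (\<lambda>_. 1)"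

definition norm0 :: "real vec \<Rightarrow> nat" where
  "norm0 t = card {i. i < dim_vec t \<and> t $ i \<noteq> 0}"

definition QAP_feasible :: "nat \<Rightarrow> nat \<Rightarrow> real vec set" where
  "QAP_feasible n M = {t \<in> carrier_vec (n * M).
     (\<forall>j<n. ones_vec M \<bullet> block M t j = 1) \<and> (\<forall>i<n * M. t $ i \<in> {0, 1})}"

definition SQP1_feasible :: "nat \<Rightarrow> nat \<Rightarrow> real vec set" where
  "SQP1_feasible n M = {t \<in> carrier_vec (n * M).
     (\<forall>j<n. ones_vec M \<bullet> block M t j = 1) \<and> 0\<^sub>v (n * M) \<le> t \<and> norm0 t \<le> n}"

definition minimizers :: "('a \<Rightarrow> real) \<Rightarrow> 'a set \<Rightarrow> 'a set" where
  "minimizers f S = {x. is_arg_min f (\<lambda>y. y \<in> S) x}"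

text \<open>Extended reals, so that the value is meaningful also for an infeasible or unbounded
  problem.\<close>

definition optimal_value :: "('a \<Rightarrow> real) \<Rightarrow> 'a set \<Rightarrow> ereal" where
  "optimal_value f S = (INF x\<in>S. ereal (f x))"

text \<open>Equivalence of two minimization problems with the same variables, each given by its objective
  function and its feasible set: the same points are feasible, the same points are
  global minimizers, and the optimal values agree.\<close>

definition equivalent_problems ::
  "('a \<Rightarrow> real) \<times> 'a set \<Rightarrow> ('a \<Rightarrow> real) \<times> 'a set \<Rightarrow> bool" where
  "equivalent_problems p q \<longleftrightarrow>
     snd p = snd q \<and>
     minimizers (fst p) (snd p) = minimizers (fst q) (snd q) \<and>
     optimal_value (fst p) (snd p) = optimal_value (fst q) (snd q)"

end

theory Submission
  imports Defs
begin

text \<open>Every block of a feasible vector sums to 1, hence has a nonzero entry. There are \<open>n\<close> blocks,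
  so at most \<open>n\<close> nonzero entries in total means exactly one in each block, and that entry is 1.
  Conversely, the number of nonzero entries of a 0-1 vector is the sum of its entries.
  So the two feasible sets coincide.\<close>

text \<open>Bridge between the flat indexing of \<open>t\<close> and its blocks:
  \<open>sum.nat_group\<close> cuts the range into intervals of length \<open>M\<close>, and each is
  shifted to start at 0.\<close>

lemma sum_blocks: "(\<Sum>i<n * M. g i) = (\<Sum>j<n. \<Sum>k<M. g (j * M + k))"
  for g :: "nat \<Rightarrow> 'a::comm_monoid_add"
proof -
  have "sum g {j * M..<j * M + M} = (\<Sum>k<M. g (j * M + k))" for j
    using sum.shift_bounds_nat_ivl[of g 0 "j * M" M]
    by (simp add: add.commute atLeast0LessThan)
  then show ?thesis
    by (simp flip: sum.nat_group)
qed

text \<open>Written as a sum of indicators, the count of nonzero entries splits by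
  \<open>sum_blocks\<close>.\<close>

lemma norm0_eq_sum:
  assumes "t \<in> carrier_vec (n * M)"
  shows "norm0 t = (\<Sum>j<n. card {k. k < M \<and> t $ (j * M + k) \<noteq> 0})"
proof -
  have ind: "card {i. i < N \<and> P i} = (\<Sum>i<N. if P i then 1 else 0)" for N and P :: "nat \<Rightarrow> bool"
    by (simp add: sum.If_cases Int_def lessThan_def)
  show ?thesis
    using assms by (simp add: norm0_def ind sum_blocks)
qed

lemma ones_vec_scalar_prod_block:
  "ones_vec M \<bullet> block M t j = (\<Sum>k<M. t $ (j * M + k))"
  by (simp add: ones_vec_def block_def scalar_prod_def lessThan_atLeast0)

text \<open>A nonzero \<open>f x\<close> is the only nonzero term, so it is the whole sum, which is
  1.\<close>

lemma sum_eq_1_at_most_one_nonzero: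
  fixes f :: "'b \<Rightarrow> 'a::semiring_1"
  assumes "finite A" and "sum f A = 1" and "card {x \<in> A. f x \<noteq> 0} \<le> 1" and "x \<in> A"
  shows "f x \<in> {0, 1}"
proof (cases "f x = 0")
  case False
  have "{x \<in> A. f x \<noteq> 0} = {x}"
    using assms False by (auto simp: card_le_Suc0_iff_eq)
  moreover have "sum f A = sum f {x \<in> A. f x \<noteq> 0}"
    using assms(1) by (intro sum.mono_neutral_right) auto
  ultimately show ?thesis
    using assms(2) by simp
qed simp

lemma QAP_feasible_subset_SQP1_feasible: "QAP_feasible n M \<subseteq> SQP1_feasible n M"
proof
  fix t assume "t \<in> QAP_feasible n M"
  then have t: "t \<in> carrier_vec (n * M)"
    and block: "\<And>j. j < n \<Longrightarrow> (\<Sum>k<M. t $ (j * M + k)) = 1"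
    and bin: "\<And>i. i < n * M \<Longrightarrow> t $ i \<in> {0, 1}"
    by (auto simp: QAP_feasible_def ones_vec_scalar_prod_block)
  have "real (norm0 t) = (\<Sum>i<n * M. if t $ i \<noteq> 0 then 1 else 0)"
    using t by (simp add: norm0_def sum.If_cases Int_def lessThan_def)
  \<comment> \<open>For a value in {0, 1}, the indicator of being nonzero is the value
    itself.\<close>
  also have "\<dots> = (\<Sum>i<n * M. t $ i)"
    using bin by (intro sum.cong) force+
  also have "\<dots> = real n"
    using block by (simp add: sum_blocks)
  finally have "norm0 t \<le> n"
    by simp
  moreover have "0\<^sub>v (n * M) \<le> t"
    using t bin by (force simp: less_eq_vec_def)
  ultimately show "t \<in> SQP1_feasible n M"
    using t block by (simp add: SQP1_feasible_def ones_vec_scalar_prod_block)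
qed

lemma SQP1_feasible_subset_QAP_feasible: "SQP1_feasible n M \<subseteq> QAP_feasible n M"
proof
  fix t assume "t \<in> SQP1_feasible n M"
  then have t: "t \<in> carrier_vec (n * M)"
    and block: "\<And>j. j < n \<Longrightarrow> (\<Sum>k<M. t $ (j * M + k)) = 1"
    and sparse: "norm0 t \<le> n"
    by (auto simp: SQP1_feasible_def ones_vec_scalar_prod_block)
  define c where "c j = card {k. k < M \<and> t $ (j * M + k) \<noteq> 0}" for j
  have c_pos: "1 \<le> c j" if j: "j < n" for j
  proof -
    \<comment> \<open>A block of zeros would sum to 0.\<close>
    obtain k where "k < M" "t $ (j * M + k) \<noteq> 0"
      using block[OF j] by (metis lessThan_iff sum.neutral zero_neq_one)
    then show ?thesis
      by (auto simp: c_def Suc_le_eq card_gt_0_iff)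
  qed
  have c_le: "c j \<le> 1" if "j < n" for j
  proof (rule ccontr)
    assume "\<not> c j \<le> 1"
    \<comment> \<open>Each of the \<open>n\<close> counts is at least 1, so a single larger one
      pushes their total, \<open>norm0 t\<close>, above \<open>n\<close>.\<close>
    then have "(\<Sum>j<n. 1) < (\<Sum>j<n. c j)"
      using that c_pos by (intro sum_strict_mono_ex1) force+
    then show False
      using sparse by (simp add: norm0_eq_sum[OF t] c_def)
  qed
  have "t $ i \<in> {0, 1}" if "i < n * M" for i
  proof -
    \<comment> \<open>If \<open>M\<close> were 0, no index \<open>i\<close> would exist; positivity
      gives \<open>i mod M < M\<close>.\<close>
    have "M > 0"
      using that by (cases M) auto
    then have "i div M < n" "i mod M < M"
      using that by (auto simp: less_mult_imp_div_less)
    \<comment> \<open>Position \<open>i\<close> is entry \<open>i mod M\<close> of block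
      \<open>i div M\<close>, and that block has at most one nonzero entry.\<close>
    then have "t $ (i div M * M + i mod M) \<in> {0, 1}"
      using sum_eq_1_at_most_one_nonzero[of "{..<M}" "\<lambda>k. t $ (i div M * M + k)" "i mod M"]
        block c_le by (simp add: c_def)
    then show ?thesis
      by simp
  qed
  then show "t \<in> QAP_feasible n M"
    using t block by (simp add: QAP_feasible_def ones_vec_scalar_prod_block)
qed

theorem proposition2p1:
  fixes m n M :: nat and H :: "complex mat" and r :: "complex vec"
  assumes "m \<ge> 1" and "n \<ge> 1" and "M \<ge> 2"
    and "H \<in> carrier_mat m n" and "r \<in> carrier_vec m"
  shows "equivalent_problems
           (h_obj n M H r, QAP_feasible n M)
           (h_obj n M H r, SQP1_feasible n M)"
proof -
  have "QAP_feasible n M = SQP1_feasible n M"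
    by (intro equalityI QAP_feasible_subset_SQP1_feasible SQP1_feasible_subset_QAP_feasible)
  then show ?thesis
    by (simp add: equivalent_problems_def)
qed

end
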